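(* Consider a network Cournot game with a system operator (NCGSO) on a market network $(A,B,c^-,c^+,H)$, with production cost functions $\Psi_i:\mathbb{R}_+^m\to\mathbb{R}_+$ ($i\in\mathcal N$), inverse demand functions $\Phi_j:\mathbb{R}\to\mathbb{R}$ ($j\in\mathcal M$), and Walrasian welfare $$\omega(x,z)=\sum_{j\in\mathcal M}\int_0^{z_j}\Phi_j(s)\,\mathrm{d}s-\sum_{i\in\mathcal N}\Psi_i(x_i).$$ For $x\in\mathcal X$ and $y\in\mathcal B_0(x)$ (a best response of the system operator to $x$), let $f=Hy$, $z=\operatorname{diag}(A'x)+By$, and $\Delta=B'\Phi(z)\in\mathbb{R}^l$, where $\Phi(z)=(\Phi_j(z_j))_{j\in\mathcal M}$, i.e. $\Delta_k=\Phi_{\tau_k}(z_{\tau_k})-\Phi_{\sigma_k}(z_{\sigma_k})$ for $k\in\mathcal L$. Then, for every link $k\in\mathcal L$ such that $\Delta_k\neq0$, there exists a link $j\in\mathcal L$ such that either $$H_{jk}\Delta_k>0\quad\text{and}\quad f_j=c_j^+,$$ or $$H_{jk}\Delta_k<0\quad\text{and}\quad f_j=-c_j^-.$$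
   Context: Market network. $\mathcal N=\{1,\dots,n\}$ is a nonempty finite set of producers, $\mathcal M=\{1,\dots,m\}$ a finite set of markets, $\mathcal L=\{1,\dots,l\}$ a finite set of links. Each link $k$ has a tail $\sigma_k\in\mathcal M$ and a head $\tau_k\in\mathcal M\setminus\{\sigma_k\}$ (parallel links are allowed). A market network is a tuple $(A,B,c^-,c^+,H)$ where: $A\in\{0,1\}^{n\times m}$ is the producer-market adjacency matrix ($A_{ij}=1$ iff producer $i$ can sell on market $j$; every producer can sell on at least one market); $B\in\{0,\pm1\}^{m\times l}$ is the market-link incidence matrix, $B_{jk}=1$ if $\tau_k=j$, $B_{jk}=-1$ if $\sigma_k=j$, $B_{jk}=0$ otherwise; $c^-,c^+\in\mathbb{R}_+^l$ are capacity vectors; $H\in\mathbb{R}^{l\times l}$ satisfies $BH=B$. Standing assumption: the market network is weakly connected, i.e. any two distinct markets are joined by a path of links ignoring orientation (equivalently $\mathrm{rank}(B)=m-1$). A prime denotes matrix transpose. Game. Producer $i$ has action set $\mathcal A_i=\{v\in\mathbb{R}_+^m: A_{ij}=0\Rightarrow v_j=0\}$, with actions $x_i=(x_{ij})_{j\in\mathcal M}$; $\mathcal X=\prod_{i\in\mathcal N}\mathcal A_i\subseteq\mathbb{R}_+^{n\times m}$. The system operator (player $0$) has action set $\mathcal Y=\{y\in\mathbb{R}^l: -c^-\le Hy\le c^+\}$ (entrywise). Let $\operatorname{diag}(A'x)\in\mathbb{R}^m$ be the vector with entries $\sum_{i\in\mathcal N}A_{ij}x_{ij}$. The system operator's utility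 is $u_0(y,x)=\omega(x,\operatorname{diag}(A'x)+By)$, and its best response set to $x$ is $\mathcal B_0(x)=\arg\max_{y\in\mathcal Y}u_0(y,x)$. (Producers' utilities play no role in the claim.)
   Formalization: The inverse demand functions Φ_j are additionally assumed continuous on ℝ; without this the claim fails, e.g. one link, H=1, c±=1, x=0, Φ_σ=0, Φ_τ(0)=1 and Φ_τ=0 elsewhere: y=0 is a best response with Δ=1 but f=0. *)

theory Defs
  imports "HOL-Analysis.Analysis"
begin

text \<open>
  Producers, markets and links are the elements of the finite index types
  \<open>'n\<close>, \<open>'m\<close> and \<open>'l\<close>; \<open>\<sigma> k\<close> and \<open>\<tau> k\<close> are the tail and the head of link \<open>k\<close>.
  An \<open>n \<times> m\<close> real matrix has type \<open>real ^ 'm ^ 'n\<close>, so \<open>x $ i\<close> is its \<open>i\<close>-th row.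
  The order on vectors is entrywise (\<open>less_eq_vec_def\<close>).
\<close>

definition incidence_matrix :: "('l::finite \<Rightarrow> 'm::finite) \<Rightarrow> ('l \<Rightarrow> 'm) \<Rightarrow> real ^ 'l ^ 'm" where
  "incidence_matrix \<sigma> \<tau> = (\<chi> j k. if \<tau> k = j then 1 else if \<sigma> k = j then - 1 else 0)"

definition weakly_connected :: "('l \<Rightarrow> 'm) \<Rightarrow> ('l \<Rightarrow> 'm) \<Rightarrow> bool" where
  "weakly_connected \<sigma> \<tau> \<longleftrightarrow>
     (let E = range (\<lambda>k. (\<sigma> k, \<tau> k)) in \<forall>i j. (i, j) \<in> (E \<union> E\<inverse>)\<^sup>*)"

locale market_network =
  fixes \<sigma> \<tau> :: "'l::finite \<Rightarrow> 'm::finite"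
    and A :: "real ^ 'm ^ 'n::finite"
    and B :: "real ^ 'l ^ 'm"
    and cminus cplus :: "real ^ 'l"
    and H :: "real ^ 'l ^ 'l"
  assumes head_neq_tail: "\<tau> k \<noteq> \<sigma> k"
    and A_entries: "A $ i $ j \<in> {0, 1}"
    and A_row: "\<exists>j. A $ i $ j = 1"
    and B_eq: "B = incidence_matrix \<sigma> \<tau>"
    and cminus_nonneg: "0 \<le> cminus"
    and cplus_nonneg: "0 \<le> cplus"
    and BH: "B ** H = B"
    and connected: "weakly_connected \<sigma> \<tau>"

definition diag :: "real ^ 'm ^ 'm \<Rightarrow> real ^ 'm" where
  "diag M = (\<chi> j. M $ j $ j)"

definition producer_actions :: "real ^ 'm ^ 'n \<Rightarrow> 'n \<Rightarrow> (real ^ 'm) set" where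
  "producer_actions A i = {v. 0 \<le> v \<and> (\<forall>j. A $ i $ j = 0 \<longrightarrow> v $ j = 0)}"

definition production_profiles :: "real ^ 'm ^ 'n \<Rightarrow> (real ^ 'm ^ 'n) set" where
  "production_profiles A = {x. \<forall>i. x $ i \<in> producer_actions A i}"

definition operator_actions ::
    "real ^ 'l \<Rightarrow> real ^ 'l \<Rightarrow> real ^ 'l ^ 'l \<Rightarrow> (real ^ 'l) set" where
  "operator_actions cminus cplus H = {y. - cminus \<le> H *v y \<and> H *v y \<le> cplus}"

definition consumption ::
    "real ^ 'm ^ 'n \<Rightarrow> real ^ 'l ^ 'm \<Rightarrow> real ^ 'm ^ 'n \<Rightarrow> real ^ 'l \<Rightarrow> real ^ 'm" where
  "consumption A B x y = diag (transpose A ** x) + B *v y"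

text \<open>
  The interval integral is oriented: for \<open>z $ j < 0\<close> it is minus the integral over
  \<open>(z $ j, 0)\<close>. Only the values of \<open>\<Psi> i\<close> on the nonnegative orthant matter.
\<close>

definition welfare ::
    "('n \<Rightarrow> real ^ 'm \<Rightarrow> real) \<Rightarrow> ('m \<Rightarrow> real \<Rightarrow> real) \<Rightarrow> real ^ 'm ^ 'n \<Rightarrow> real ^ 'm \<Rightarrow> real" where
  "welfare \<Psi> \<Phi> x z =
     (\<Sum>j\<in>UNIV. LBINT s=0..ereal (z $ j). \<Phi> j s) - (\<Sum>i\<in>UNIV. \<Psi> i (x $ i))"

definition operator_utility ::
    "real ^ 'm ^ 'n \<Rightarrow> real ^ 'l ^ 'm \<Rightarrow> ('n \<Rightarrow> real ^ 'm \<Rightarrow> real) \<Rightarrow> ('m \<Rightarrow> real \<Rightarrow> real) \<Rightarrow>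
     real ^ 'l \<Rightarrow> real ^ 'm ^ 'n \<Rightarrow> real" where
  "operator_utility A B \<Psi> \<Phi> y x = welfare \<Psi> \<Phi> x (consumption A B x y)"

definition operator_best_responses ::
    "real ^ 'm ^ 'n \<Rightarrow> real ^ 'l ^ 'm \<Rightarrow> real ^ 'l \<Rightarrow> real ^ 'l \<Rightarrow> real ^ 'l ^ 'l \<Rightarrow>
     ('n \<Rightarrow> real ^ 'm \<Rightarrow> real) \<Rightarrow> ('m \<Rightarrow> real \<Rightarrow> real) \<Rightarrow> real ^ 'm ^ 'n \<Rightarrow> (real ^ 'l) set" where
  "operator_best_responses A B cminus cplus H \<Psi> \<Phi> x =
     {y. is_arg_max (\<lambda>y. operator_utility A B \<Psi> \<Phi> y x)
           (\<lambda>y. y \<in> operator_actions cminus cplus H) y}"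

end

theory Submission
  imports Defs
begin

text \<open>
  First-order optimality along a single link: the derivative of the operator's utility in the
  direction \<open>\<Delta>\<^sub>k e\<^sub>k\<close> is \<open>\<Delta>\<^sub>k\<^sup>2\<close>, so this direction must be infeasible at a best response with
  \<open>\<Delta>\<^sub>k \<noteq> 0\<close>. It changes the flow on link \<open>j\<close> at rate \<open>H\<^sub>j\<^sub>k \<Delta>\<^sub>k\<close>, and infeasibility means that
  some flow is pushed against a tight capacity.
\<close>

lemma DERIV_interval_integral_upper:
  fixes g :: "real \<Rightarrow> real"
  assumes "continuous_on UNIV g"
  shows "((\<lambda>u. LBINT s=0..ereal u. g s) has_real_derivative g u) (at u)"
proof -
  \<comment> \<open>The interval from \<open>?a\<close> to \<open>?b\<close> contains 0 and has
    \<open>u\<close> in its interior, whatever the sign of \<open>u\<close>. The fundamental theorem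
    of calculus on it therefore covers the oriented integral and gives a two-sided
    derivative.\<close>
  let ?a = "- \<bar>u\<bar> - 1" and ?b = "\<bar>u\<bar> + 1"
  have "((\<lambda>u. LBINT s=ereal 0..ereal u. g s) has_vector_derivative g u) (at u within {?a..?b})"
    by (rule interval_integral_FTC2) (use assms continuous_on_subset in auto)
  moreover have "at u within {?a..?b} = at u"
    by (rule at_within_interior) (simp add: interior_atLeastAtMost_real, linarith)
  ultimately show ?thesis
    by (simp add: has_real_derivative_iff_has_vector_derivative zero_ereal_def)
qed

text \<open>The chain rule applies market by market; the production costs are constant along the
  line because \<open>x\<close> stays fixed.\<close>

lemma DERIV_welfare_line:
  fixes \<Phi> :: "'m::finite \<Rightarrow> real \<Rightarrow> real" and z w :: "real ^ 'm"
  assumes "\<And>j. continuous_on UNIV (\<Phi> j)"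
  shows "((\<lambda>t. welfare \<Psi> \<Phi> x (z + t *\<^sub>R w)) has_real_derivative (\<chi> j. \<Phi> j (z $ j)) \<bullet> w) (at 0)"
proof -
  have "((\<lambda>t. LBINT s=0..ereal (z $ j + t * w $ j). \<Phi> j s) has_real_derivative \<Phi> j (z $ j) * w $ j)
      (at 0)" for j
  proof (rule DERIV_chain2[where g = "\<lambda>t. z $ j + t * w $ j"])
    show "((\<lambda>u. LBINT s=0..ereal u. \<Phi> j s) has_real_derivative \<Phi> j (z $ j))
        (at (z $ j + 0 * w $ j))"
      using DERIV_interval_integral_upper[OF assms] by simp
  qed (auto intro!: derivative_eq_intros)
  then have "((\<lambda>t. (\<Sum>j\<in>UNIV. LBINT s=0..ereal (z $ j + t * w $ j). \<Phi> j s) - (\<Sum>i\<in>UNIV. \<Psi> i (x $ i)))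
      has_real_derivative (\<Sum>j\<in>UNIV. \<Phi> j (z $ j) * w $ j) - 0) (at 0)"
    by (intro DERIV_diff DERIV_sum DERIV_const)
  then show ?thesis
    by (simp add: welfare_def inner_vec_def)
qed

text \<open>For \<open>b\<close> at most 0 the bound persists for every \<open>t > 0\<close>; for
  positive \<open>b\<close> the strict slack at \<open>t = 0\<close> survives by continuity.\<close>

lemma eventually_le_line:
  fixes a b c :: real
  assumes "a \<le> c" and "0 < b \<Longrightarrow> a < c"
  shows "\<forall>\<^sub>F t in at_right 0. a + t * b \<le> c"
proof (cases "0 < b")
  case True
  have "((\<lambda>t. a + t * b) \<longlongrightarrow> a + 0 * b) (at_right 0)"
    by (intro tendsto_intros)
  then have "\<forall>\<^sub>F t in at_right 0. a + t * b < c"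
    using assms(2)[OF True] by (intro order_tendstoD(2)) auto
  then show ?thesis
    by (rule eventually_mono) simp
next
  case False
  then have "a + t * b \<le> c" if "t > 0" for t
    using assms(1) mult_nonneg_nonpos[of t b] that by simp
  then show ?thesis
    by (auto intro: eventually_mono[OF eventually_at_right_less])
qed

text \<open>A small move along \<open>d\<close> can break only a capacity that is already tight and
  towards which \<open>d\<close> pushes. With finitely many links, one range of small
  \<open>t\<close> serves all constraints.\<close>

lemma eventually_operator_actions_line:
  assumes "y \<in> operator_actions cminus cplus H"
    and "\<And>j. 0 < (H *v d) $ j \<Longrightarrow> (H *v y) $ j \<noteq> cplus $ j"
    and "\<And>j. (H *v d) $ j < 0 \<Longrightarrow> (H *v y) $ j \<noteq> - (cminus $ j)"
  shows "\<forall>\<^sub>F t in at_right 0. y + t *\<^sub>R d \<in> operator_actions cminus cplus H"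
proof -
  have le: "- (cminus $ j) \<le> (H *v y) $ j" "(H *v y) $ j \<le> cplus $ j" for j
    using assms(1) by (auto simp: operator_actions_def less_eq_vec_def)
  have "\<forall>\<^sub>F t in at_right 0. \<forall>j. (H *v y) $ j + t * (H *v d) $ j \<le> cplus $ j"
    by (intro eventually_all_finite eventually_le_line) (use le assms(2) in \<open>auto simp: less_le\<close>)
  \<comment> \<open>Negation turns the lower capacities into upper bounds, so
    \<open>eventually_le_line\<close> handles them too.\<close>
  moreover have "\<forall>\<^sub>F t in at_right 0. \<forall>j. - (H *v y) $ j + t * - (H *v d) $ j \<le> cminus $ j"
  proof (intro eventually_all_finite eventually_le_line)
    fix j
    show "- (H *v y) $ j \<le> cminus $ j"
      using le(1)[of j] by simp
    show "- (H *v y) $ j < cminus $ j" if "0 < - (H *v d) $ j"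
      using le(1)[of j] assms(3)[of j] that by simp
  qed
  ultimately show ?thesis
  proof eventually_elim
    case (elim t)
    have "- (cminus $ j) \<le> (H *v y) $ j + t * (H *v d) $ j" for j
      using elim(2)[rule_format, of j] by simp
    then show ?case
      using elim(1)
      by (simp add: operator_actions_def less_eq_vec_def matrix_vector_right_distrib
          matrix_vector_mult_scaleR)
  qed
qed

text \<open>A positive directional derivative would give strictly higher utility at small feasible
  steps, contradicting optimality of \<open>y\<close>.\<close>

lemma best_response_first_order:
  assumes "\<And>j. continuous_on UNIV (\<Phi> j)"
    and "y \<in> operator_best_responses A B cminus cplus H \<Psi> \<Phi> x"
    and "\<forall>\<^sub>F t in at_right 0. y + t *\<^sub>R d \<in> operator_actions cminus cplus H"
  shows "(transpose B *v (\<chi> j. \<Phi> j (consumption A B x y $ j))) \<bullet> d \<le> 0"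
proof (rule ccontr)
  let ?z = "consumption A B x y"
  let ?h = "\<lambda>t. welfare \<Psi> \<Phi> x (?z + t *\<^sub>R (B *v d))"
  assume "\<not> ?thesis"
  \<comment> \<open>Moving \<open>B\<close> across the inner product turns the link direction
    \<open>d\<close> into the consumption direction \<open>B *v d\<close>.\<close>
  then have "(\<chi> j. \<Phi> j (?z $ j)) \<bullet> (B *v d) > 0"
    by (simp add: dot_lmul_matrix)
  from DERIV_pos_inc_right[OF DERIV_welfare_line[OF assms(1)] this]
  have "\<forall>\<^sub>F t in at_right 0. ?h 0 < ?h t"
    by (force simp: eventually_at_right_field)
  \<comment> \<open>A contradiction for all small \<open>t > 0\<close> suffices, since
    \<open>at_right 0\<close> is a nontrivial filter.\<close>
  with assms(3) have "\<forall>\<^sub>F t in at_right (0::real). False"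
  proof eventually_elim
    case (elim t)
    have "consumption A B x (y + t *\<^sub>R d) = ?z + t *\<^sub>R (B *v d)"
      by (simp add: consumption_def matrix_vector_right_distrib matrix_vector_mult_scaleR)
    with elim assms(2) show False
      by (auto simp: operator_best_responses_def is_arg_max_def operator_utility_def)
  qed
  then show False
    by simp
qed

theorem theorem3:
  fixes \<sigma> \<tau> :: "'l::finite \<Rightarrow> 'm::finite"
    and A :: "real ^ 'm ^ 'n::finite"
    and B :: "real ^ 'l ^ 'm"
    and cminus cplus :: "real ^ 'l"
    and H :: "real ^ 'l ^ 'l"
    and \<Psi> :: "'n \<Rightarrow> real ^ 'm \<Rightarrow> real"
    and \<Phi> :: "'m \<Rightarrow> real \<Rightarrow> real"
    and x :: "real ^ 'm ^ 'n"
    and y f \<Delta> :: "real ^ 'l"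
    and z :: "real ^ 'm"
  assumes "market_network \<sigma> \<tau> A B cminus cplus H"
    and "\<And>i v. 0 \<le> v \<Longrightarrow> 0 \<le> \<Psi> i v"
    and "\<And>j. continuous_on UNIV (\<Phi> j)"
    and "x \<in> production_profiles A"
    and "y \<in> operator_best_responses A B cminus cplus H \<Psi> \<Phi> x"
    and "f = H *v y"
    and "z = diag (transpose A ** x) + B *v y"
    and "\<Delta> = transpose B *v (\<chi> j. \<Phi> j (z $ j))"
  shows "\<forall>k. \<Delta> $ k \<noteq> 0 \<longrightarrow>
    (\<exists>j. (H $ j $ k * \<Delta> $ k > 0 \<and> f $ j = cplus $ j) \<or>
         (H $ j $ k * \<Delta> $ k < 0 \<and> f $ j = - (cminus $ j)))"
proof (intro allI impI)
  fix k
  assume k: "\<Delta> $ k \<noteq> 0"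
  \<comment> \<open>The factor \<open>\<Delta> $ k\<close> orients the step towards the higher
    price, so both signs are treated at once.\<close>
  define d where "d = axis k (\<Delta> $ k)"
  have Hd: "(H *v d) $ j = H $ j $ k * \<Delta> $ k" for j
    by (simp add: d_def matrix_vector_mult_def axis_def if_distrib cong: if_cong)
  have "\<Delta> \<bullet> d = \<Delta> $ k * \<Delta> $ k"
    by (simp add: d_def inner_axis)
  moreover have "\<Delta> $ k * \<Delta> $ k > 0"
    using k by (auto simp: zero_less_mult_iff linorder_neq_iff)
  ultimately have "\<not> (\<forall>\<^sub>F t in at_right 0. y + t *\<^sub>R d \<in> operator_actions cminus cplus H)"
    using best_response_first_order[OF assms(3,5)] assms(7,8)
    by (fastforce simp: consumption_def)
  moreover have "y \<in> operator_actions cminus cplus H"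
    using assms(5) by (simp add: operator_best_responses_def is_arg_max_def)
  \<comment> \<open>By contraposition of \<open>eventually_operator_actions_line\<close>, one of its
    two conditions on tight capacities fails at some \<open>j\<close>; the two cases are the two
    disjuncts.\<close>
  ultimately show "\<exists>j. (H $ j $ k * \<Delta> $ k > 0 \<and> f $ j = cplus $ j) \<or>
      (H $ j $ k * \<Delta> $ k < 0 \<and> f $ j = - (cminus $ j))"
    using eventually_operator_actions_line[of y cminus cplus H d] assms(6) Hd by auto
qed

end
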